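(* Let $\mathbf{k}$ be an integral domain with unity having more than two elements. Let $p:X\to Y$ be a non-trivial quandle covering (if $X$ is finite, assume that $|X|$ is not invertible in $\mathbf{k}$). Then $\mathbf{k}[X]$ has right zero-divisors.
   Context: A quandle is a non-empty set $X$ with a binary operation $*$ such that, for each $y\in X$, the map $S_y:X\to X$, $S_y(x)=x*y$, is an automorphism of $(X,* )$ and $S_y(y)=y$. A quandle homomorphism $p:X\to Y$ is a quandle covering if it is surjective and $S_x=S_{x'}$ whenever $p(x)=p(x')$; it is non-trivial if it is not an isomorphism. The quandle ring $\mathbf{k}[X]$ is the free $\mathbf{k}$-module with basis $\{e_x\mid x\in X\}$ with the (in general non-associative) $\mathbf{k}$-bilinear product determined by $e_xe_y=e_{x*y}$. A non-zero $u\in\mathbf{k}[X]$ is a right zero-divisor if there is a non-zero $v\in\mathbf{k}[X]$ with $vu=0$. *)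

theory Defs
  imports Main "HOL-Library.Poly_Mapping" "HOL-Library.FuncSet"
begin

text \<open>
  A binary structure is given by a carrier set \<open>X\<close> and an operation \<open>m\<close>, written \<open>x * y\<close> in the
  literature; only the values of \<open>m\<close> on \<open>X\<close> matter.
\<close>

definition magma_hom :: "'a set \<Rightarrow> ('a \<Rightarrow> 'a \<Rightarrow> 'a) \<Rightarrow> 'b set \<Rightarrow> ('b \<Rightarrow> 'b \<Rightarrow> 'b) \<Rightarrow> ('a \<Rightarrow> 'b) \<Rightarrow> bool"
  where "magma_hom X m Y n f \<longleftrightarrow>
    f \<in> X \<rightarrow> Y \<and> (\<forall>x\<in>X. \<forall>x'\<in>X. f (m x x') = n (f x) (f x'))"

definition magma_iso :: "'a set \<Rightarrow> ('a \<Rightarrow> 'a \<Rightarrow> 'a) \<Rightarrow> 'b set \<Rightarrow> ('b \<Rightarrow> 'b \<Rightarrow> 'b) \<Rightarrow> ('a \<Rightarrow> 'b) \<Rightarrow> bool"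
  where "magma_iso X m Y n f \<longleftrightarrow> magma_hom X m Y n f \<and> bij_betw f X Y"

definition right_translation :: "('a \<Rightarrow> 'a \<Rightarrow> 'a) \<Rightarrow> 'a \<Rightarrow> 'a \<Rightarrow> 'a"
  where "right_translation m y = (\<lambda>x. m x y)"

definition quandle :: "'a set \<Rightarrow> ('a \<Rightarrow> 'a \<Rightarrow> 'a) \<Rightarrow> bool"
  where "quandle X m \<longleftrightarrow>
    X \<noteq> {} \<and>
    (\<forall>x\<in>X. \<forall>y\<in>X. m x y \<in> X) \<and>
    (\<forall>y\<in>X. magma_iso X m X m (right_translation m y) \<and> right_translation m y y = y)"

definition quandle_covering ::
  "'a set \<Rightarrow> ('a \<Rightarrow> 'a \<Rightarrow> 'a) \<Rightarrow> 'b set \<Rightarrow> ('b \<Rightarrow> 'b \<Rightarrow> 'b) \<Rightarrow> ('a \<Rightarrow> 'b) \<Rightarrow> bool"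
  where "quandle_covering X m Y n p \<longleftrightarrow>
    magma_hom X m Y n p \<and> p ` X = Y \<and>
    (\<forall>x\<in>X. \<forall>x'\<in>X. p x = p x' \<longrightarrow>
       (\<forall>z\<in>X. right_translation m x z = right_translation m x' z))"

definition nontrivial_quandle_covering ::
  "'a set \<Rightarrow> ('a \<Rightarrow> 'a \<Rightarrow> 'a) \<Rightarrow> 'b set \<Rightarrow> ('b \<Rightarrow> 'b \<Rightarrow> 'b) \<Rightarrow> ('a \<Rightarrow> 'b) \<Rightarrow> bool"
  where "nontrivial_quandle_covering X m Y n p \<longleftrightarrow>
    quandle_covering X m Y n p \<and> \<not> magma_iso X m Y n p"

text \<open>
  Elements of the quandle ring are finitely supported functions with support in \<open>X\<close>; the basis
  element \<open>e\<^sub>x\<close> is \<open>Poly_Mapping.single x 1\<close>. The library product on \<^typ>\<open>'a \<Rightarrow>\<^sub>0 'k\<close> is convolution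
  with respect to addition on the index type, so it is not used here.
\<close>

definition qring_carrier :: "'a set \<Rightarrow> ('a \<Rightarrow>\<^sub>0 'k::comm_ring_1) set"
  where "qring_carrier X = {u. Poly_Mapping.keys u \<subseteq> X}"

definition qring_mult ::
  "('a \<Rightarrow> 'a \<Rightarrow> 'a) \<Rightarrow> ('a \<Rightarrow>\<^sub>0 'k::comm_ring_1) \<Rightarrow> ('a \<Rightarrow>\<^sub>0 'k) \<Rightarrow> ('a \<Rightarrow>\<^sub>0 'k)"
  where "qring_mult m u v =
    (\<Sum>x\<in>Poly_Mapping.keys u. \<Sum>y\<in>Poly_Mapping.keys v.
       Poly_Mapping.single (m x y) (Poly_Mapping.lookup u x * Poly_Mapping.lookup v y))"

lemma qring_mult_single:
  "qring_mult m (Poly_Mapping.single x a) (Poly_Mapping.single y b)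
    = Poly_Mapping.single (m x y) (a * b)"
  by (cases "a = 0"; cases "b = 0") (simp_all add: qring_mult_def)

definition qring_right_zero_divisor ::
  "'a set \<Rightarrow> ('a \<Rightarrow> 'a \<Rightarrow> 'a) \<Rightarrow> ('a \<Rightarrow>\<^sub>0 'k::comm_ring_1) \<Rightarrow> bool"
  where "qring_right_zero_divisor X m u \<longleftrightarrow>
    u \<in> qring_carrier X \<and> u \<noteq> 0 \<and>
    (\<exists>v\<in>qring_carrier X. v \<noteq> 0 \<and> qring_mult m v u = 0)"

end

theory Submission
  imports Defs
begin

text \<open>
  A covering that is not an isomorphism identifies two distinct points \<open>x\<close> and \<open>y\<close>. These act
  by the same right translation, so \<open>e\<^sub>z (e\<^sub>x - e\<^sub>y) = 0\<close> for every \<open>z\<close>.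
\<close>

text \<open>A covering is already a surjective homomorphism, so injectivity is the only condition of
  \<open>magma_iso\<close> that can fail.\<close>

lemma nontrivial_quandle_covering_not_inj_on:
  assumes "nontrivial_quandle_covering X m Y n p"
  shows "\<not> inj_on p X"
  using assms
  by (auto simp: nontrivial_quandle_covering_def quandle_covering_def magma_iso_def bij_betw_def)

text \<open>The coefficients \<open>1\<close> and \<open>-1\<close> sit at different points and
  cannot cancel. Knowing the support exactly turns the inner sum of \<open>qring_mult\<close> into a
  sum of two terms.\<close>

lemma keys_single_diff_single:
  assumes "x \<noteq> x'"
  shows "Poly_Mapping.keys (Poly_Mapping.single x 1 - Poly_Mapping.single x' 1
    :: 'a \<Rightarrow>\<^sub>0 'k::comm_ring_1) = {x, x'}"
  using assms
  by (auto simp: in_keys_iff lookup_minus lookup_single when_def split: if_splits)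

text \<open>Both terms of the product lie over the same basis element, with coefficients
  \<open>1\<close> and \<open>-1\<close>, and cancel.\<close>

lemma qring_mult_single_diff:
  assumes "x \<noteq> x'" and "m z x = m z x'"
  shows "qring_mult m (Poly_Mapping.single z 1)
    (Poly_Mapping.single x 1 - Poly_Mapping.single x' 1 :: 'a \<Rightarrow>\<^sub>0 'k::comm_ring_1) = 0"
  using assms
  by (simp add: qring_mult_def keys_single_diff_single lookup_minus lookup_single single_uminus)

lemma qring_right_zero_divisor_single_diff:
  assumes "x \<in> X" "x' \<in> X" "x \<noteq> x'" "z \<in> X" "m z x = m z x'"
  shows "qring_right_zero_divisor X m
    (Poly_Mapping.single x 1 - Poly_Mapping.single x' 1 :: 'a \<Rightarrow>\<^sub>0 'k::comm_ring_1)"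
  unfolding qring_right_zero_divisor_def
proof (intro conjI bexI)
  let ?u = "Poly_Mapping.single x 1 - Poly_Mapping.single x' 1 :: 'a \<Rightarrow>\<^sub>0 'k"
  show "?u \<in> qring_carrier X"
    using assms by (simp add: qring_carrier_def keys_single_diff_single)
  show "?u \<noteq> 0"
    \<comment> \<open>The support is non-empty, whereas that of \<open>0\<close> is empty.\<close>
    using keys_single_diff_single[OF \<open>x \<noteq> x'\<close>, where 'k = 'k] by force
  show "Poly_Mapping.single z 1 \<noteq> (0 :: 'a \<Rightarrow>\<^sub>0 'k)"
    by (metis lookup_single_eq lookup_zero zero_neq_one)
  show "qring_mult m (Poly_Mapping.single z 1) ?u = 0"
    using assms by (intro qring_mult_single_diff)
  show "Poly_Mapping.single z 1 \<in> (qring_carrier X :: ('a \<Rightarrow>\<^sub>0 'k) set)"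
    using assms by (simp add: qring_carrier_def)
qed

theorem proposition4p9:
  fixes X :: "'a set" and m :: "'a \<Rightarrow> 'a \<Rightarrow> 'a"
    and Y :: "'b set" and n :: "'b \<Rightarrow> 'b \<Rightarrow> 'b"
    and p :: "'a \<Rightarrow> 'b"
  assumes "infinite (UNIV :: 'k::idom set) \<or> card (UNIV :: 'k set) > 2"
    and "quandle X m" and "quandle Y n"
    and "nontrivial_quandle_covering X m Y n p"
    and "finite X \<Longrightarrow> \<not> (of_nat (card X) :: 'k) dvd 1"
  shows "\<exists>u :: 'a \<Rightarrow>\<^sub>0 'k. qring_right_zero_divisor X m u"
proof -
  obtain x x' where x: "x \<in> X" "x' \<in> X" "x \<noteq> x'" "p x = p x'"
    using nontrivial_quandle_covering_not_inj_on[OF assms(4)] by (auto simp: inj_on_def)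
  \<comment> \<open>The equal right translations by \<open>x\<close> and \<open>x'\<close> are
    evaluated at the point \<open>x\<close>, so the annihilating left factor is the basis element of
    \<open>x\<close> itself.\<close>
  moreover have "m x x = m x x'"
    using assms(4) x
    unfolding nontrivial_quandle_covering_def quandle_covering_def right_translation_def by blast
  ultimately show ?thesis
    using qring_right_zero_divisor_single_diff[of x X x' x m, where 'k = 'k] by blast
qed

end
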